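(* Let $\mu$ be a measure with support $\Lambda$, let $N\ge1$, and let $K:\Lambda\times\Lambda\to\mathbb{C}$ be a (not necessarily hermitian) kernel which is positive definite, in the sense that $\det[K(x_i,x_j)]_{i,j=1}^k\ge0$ for every $k\ge1$ and $x_1,\dots,x_k\in\Lambda$, and satisfies $$\int K(x,x)\,\mu(dx)=N,\qquad\int K(x,u)K(u,y)\,\mu(du)=K(x,y),\quad x,y\in\Lambda.$$ Let $\mathbb{P}$ be the probability measure on $\Lambda^N$ defined by $$d\mathbb{P}(x_1,\dots,x_N)=\frac1{N!}\det\big[K(x_i,x_j)\big]_{i,j=1}^N\prod_{j=1}^N\mu(dx_j).$$ Set $\eta_1(dx_1)=\frac1NK(x_1,x_1)\,\mu(dx_1)$ and, for $1\le k\le N-1$ and $x_1,\dots,x_k$ with $\det[K(x_i,x_j)]_{i,j=1}^k>0$, $$\eta_{k+1}(dx_{k+1}|x_1,\dots,x_k)=\frac1{N-k}\,\frac{\det[K(x_i,x_j)]_{i,j=1}^{k+1}}{\det[K(x_i,x_j)]_{i,j=1}^{k}}\,\mu(dx_{k+1}),$$ with $\eta_{k+1}(\cdot|x_1,\dots,x_k)$ set to be zero otherwise. Then: (i) for $\mathbb{P}$-almost every $(x_1,\dots,x_N)$ one has $\det[K(x_i,x_j)]_{i,j=1}^k>0$ for every $1\le k\le N$; (ii) $\eta_1$ is a probability measure, and for every $1\le k\le N-1$ and every $x_1,\dots,x_k$ such that $\det[K(x_i,x_j)]_{i,j=1}^k>0$, $\eta_{k+1}(\cdot|x_1,\dots,x_k)$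 is a probability measure; (iii) $d\mathbb{P}(x_1,\dots,x_N)=\eta_1(dx_1)\prod_{k=2}^N\eta_k(dx_k|x_1,\dots,x_{k-1})$; consequently, sampling successively $x_1$ from $\eta_1$, $x_2$ from $\eta_2(\cdot|x_1)$, $\dots$, $x_N$ from $\eta_N(\cdot|x_1,\dots,x_{N-1})$ produces $(x_1,\dots,x_N)$ with distribution $\mathbb{P}$; (iv) for every $1\le k\le N-1$ and $x_1,\dots,x_k$ with $\det[K(x_i,x_j)]_{i,j=1}^k>0$, the density of $\eta_{k+1}(\cdot|x_1,\dots,x_k)$ is $$\frac{\eta_{k+1}(dx|x_1,\dots,x_k)}{\mu(dx)}=\frac1{N-k}\left(K(x,x)-\begin{bmatrix}K(x,x_1)\\ \vdots\\ K(x,x_k)\end{bmatrix}^T\Big([K(x_i,x_j)]_{i,j=1}^k\Big)^{-1}\begin{bmatrix}K(x_1,x)\\ \vdots\\ K(x_k,x)\end{bmatrix}\right).$$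
   Context: It is a well-known fact that, under the stated assumptions on $K$, $\mathbb{P}$ is a probability measure on $\Lambda^N$ and that the point process $x_1,\dots,x_N$ it generates is determinantal with kernel $K$ with respect to $\mu$. The kernel $K$ is associated with a rank $N$ projection acting on $L^2(\mu)$, not necessarily orthogonal. The symbol $^T$ denotes the transpose (without conjugation). *)

theory Defs
  imports
    "HOL-Probability.Probability"
    "HOL-Library.Complex_Order"
    "Jordan_Normal_Form.Gauss_Jordan_Elimination"
    "Jordan_Normal_Form.Determinant"
begin

text \<open>
  Points are numbered from 0: the point \<open>x\<^sub>i\<close> of the usual notation \<open>x\<^sub>1, \<dots>, x\<^sub>k\<close> is \<open>x (i - 1)\<close>,
  and only the values \<open>x 0, \<dots>, x (k - 1)\<close> of \<open>x :: nat \<Rightarrow> 'a\<close> matter below. Points of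
  \<open>\<Lambda>\<^sup>N\<close> are the extensional functions in \<open>{..<N} \<rightarrow>\<^sub>E \<Lambda>\<close>.
  In all definitions the measure \<open>\<mu>\<close> is meant to live on \<open>\<Lambda>\<close> itself, i.e. \<open>space \<mu> = \<Lambda>\<close>.
  The order on complex numbers is the one where \<open>0 \<le> z\<close> (\<open>0 < z\<close>) means that \<open>z\<close> is real and
  nonnegative (positive).
\<close>

definition kernel_matrix :: "('a \<Rightarrow> 'a \<Rightarrow> complex) \<Rightarrow> nat \<Rightarrow> (nat \<Rightarrow> 'a) \<Rightarrow> complex mat" where
  "kernel_matrix K k x = Matrix.mat k k (\<lambda>(i, j). K (x i) (x j))"

definition kernel_det :: "('a \<Rightarrow> 'a \<Rightarrow> complex) \<Rightarrow> nat \<Rightarrow> (nat \<Rightarrow> 'a) \<Rightarrow> complex" where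
  "kernel_det K k x = Determinant.det (kernel_matrix K k x)"

definition positive_definite_kernel :: "'a set \<Rightarrow> ('a \<Rightarrow> 'a \<Rightarrow> complex) \<Rightarrow> bool" where
  "positive_definite_kernel \<Lambda> K \<longleftrightarrow>
     (\<forall>k\<ge>1. \<forall>x. (\<forall>i<k. x i \<in> \<Lambda>) \<longrightarrow> 0 \<le> kernel_det K k x)"

definition determinantal_law ::
  "'a measure \<Rightarrow> ('a \<Rightarrow> 'a \<Rightarrow> complex) \<Rightarrow> nat \<Rightarrow> (nat \<Rightarrow> 'a) measure" where
  "determinantal_law \<mu> K N =
     density (Pi\<^sub>M {..<N} (\<lambda>_. \<mu>)) (\<lambda>x. ennreal (Re (kernel_det K N x) / fact N))"

definition eta_first :: "'a measure \<Rightarrow> ('a \<Rightarrow> 'a \<Rightarrow> complex) \<Rightarrow> nat \<Rightarrow> 'a measure" where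
  "eta_first \<mu> K N = density \<mu> (\<lambda>y. ennreal (1 / real N * Re (K y y)))"

text \<open>\<open>eta_next_density K N k x\<close> is the ratio defining the density of \<open>\<eta>\<^bsub>k+1\<^esub>(\<cdot> | x\<^sub>1, \<dots>, x\<^sub>k)\<close>;
  the update \<open>x(k := y)\<close> appends \<open>y\<close> to the first \<open>k\<close> points.\<close>

definition eta_next_density ::
  "('a \<Rightarrow> 'a \<Rightarrow> complex) \<Rightarrow> nat \<Rightarrow> nat \<Rightarrow> (nat \<Rightarrow> 'a) \<Rightarrow> 'a \<Rightarrow> complex" where
  "eta_next_density K N k x y =
     1 / of_real (real N - real k) * (kernel_det K (k + 1) (x(k := y)) / kernel_det K k x)"

definition eta_next ::
  "'a measure \<Rightarrow> ('a \<Rightarrow> 'a \<Rightarrow> complex) \<Rightarrow> nat \<Rightarrow> nat \<Rightarrow> (nat \<Rightarrow> 'a) \<Rightarrow> 'a measure" where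
  "eta_next \<mu> K N k x =
     (if 0 < kernel_det K k x
      then density \<mu> (\<lambda>y. ennreal (Re (eta_next_density K N k x y)))
      else null_measure \<mu>)"

text \<open>The law of the next point when \<open>k\<close> points \<open>x 0, \<dots>, x (k - 1)\<close> have already been sampled.\<close>

definition eta ::
  "'a measure \<Rightarrow> ('a \<Rightarrow> 'a \<Rightarrow> complex) \<Rightarrow> nat \<Rightarrow> nat \<Rightarrow> (nat \<Rightarrow> 'a) \<Rightarrow> 'a measure" where
  "eta \<mu> K N k x = (if k = 0 then eta_first \<mu> K N else eta_next \<mu> K N k x)"

text \<open>
  \<open>iterated_integral \<mu> K N N 0 (\<lambda>_. undefined) f\<close> is the iterated integral
  \<open>\<integral> \<eta>\<^sub>1(dx\<^sub>1) \<integral> \<eta>\<^sub>2(dx\<^sub>2 | x\<^sub>1) \<dots> \<integral> \<eta>\<^sub>N(dx\<^sub>N | x\<^sub>1, \<dots>, x\<^bsub>N-1\<^esub>) f(x\<^sub>1, \<dots>, x\<^sub>N)\<close>, the integral of \<open>f\<close> against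
  \<open>\<eta>\<^sub>1(dx\<^sub>1) \<Prod>\<^sub>k \<eta>\<^sub>k(dx\<^sub>k | x\<^sub>1, \<dots>, x\<^bsub>k-1\<^esub>)\<close>. In general, the argument \<open>n\<close> counts the variables that remain
  to be integrated and \<open>k\<close> those already fixed in \<open>x\<close>.
\<close>

primrec iterated_integral ::
  "'a measure \<Rightarrow> ('a \<Rightarrow> 'a \<Rightarrow> complex) \<Rightarrow> nat \<Rightarrow> nat \<Rightarrow> nat \<Rightarrow> (nat \<Rightarrow> 'a)
     \<Rightarrow> ((nat \<Rightarrow> 'a) \<Rightarrow> ennreal) \<Rightarrow> ennreal" where
  "iterated_integral \<mu> K N 0 k x f = f x"
| "iterated_integral \<mu> K N (Suc n) k x f =
     (\<integral>\<^sup>+ y. iterated_integral \<mu> K N n (Suc k) (x(k := y)) f \<partial>eta \<mu> K N k x)"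

text \<open>The law of the first \<open>k\<close> points of the sequential sampling procedure, in the Giry monad.\<close>

primrec sequential_law ::
  "'a measure \<Rightarrow> ('a \<Rightarrow> 'a \<Rightarrow> complex) \<Rightarrow> nat \<Rightarrow> nat \<Rightarrow> (nat \<Rightarrow> 'a) measure" where
  "sequential_law \<mu> K N 0 = return (Pi\<^sub>M {..<0} (\<lambda>_. \<mu>)) (\<lambda>_. undefined)"
| "sequential_law \<mu> K N (Suc k) =
     Giry_Monad.bind (sequential_law \<mu> K N k)
       (\<lambda>x. distr (eta \<mu> K N k x) (Pi\<^sub>M {..<Suc k} (\<lambda>_. \<mu>)) (\<lambda>y. x(k := y)))"

text \<open>The product of row vector, inverse matrix and column vector; \<open>scalar_prod\<close> does not conjugate.
  \<open>mat_inverse\<close> returns \<open>None\<close> for singular matrices.\<close>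

definition schur_density ::
  "('a \<Rightarrow> 'a \<Rightarrow> complex) \<Rightarrow> nat \<Rightarrow> nat \<Rightarrow> (nat \<Rightarrow> 'a) \<Rightarrow> 'a \<Rightarrow> complex" where
  "schur_density K N k x y =
     1 / of_real (real N - real k) *
       (K y y - scalar_prod (Matrix.vec k (\<lambda>i. K y (x i)))
                  (mult_mat_vec (the (mat_inverse (kernel_matrix K k x)))
                     (Matrix.vec k (\<lambda>i. K (x i) y))))"

end

theory Submission
  imports Defs
begin

text \<open>
  Write \<open>D k x\<close> for the determinant of \<open>[K (x i) (x j)]\<close> with \<open>i, j < k\<close>. Expanding the bordered determinant
  \<open>D (k + 1) (x, y)\<close> along its last column and row and integrating over \<open>y\<close>, the trace condition and
  the reproducing property give \<open>\<integral> D (k + 1) (x, y) \<nu>(dy) = (N - k) D k x\<close>. Hence each \<open>\<eta>\<close> has mass one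
  where \<open>D k x > 0\<close>, and where \<open>D k x = 0\<close> the nonnegative function \<open>D (k + 1) (x, \<cdot>)\<close> vanishes almost
  everywhere. So \<open>D k x (N - k)! / N!\<close> is the density of the law of the first \<open>k\<close> sampled points, by
  telescoping. The same expansion, divided by \<open>D k x\<close>, is the Schur complement formula, because the
  inverse matrix is the adjugate over the determinant.
\<close>

section \<open>Bordered determinants\<close>

text \<open>Laplace expansion along the last column, then of each remaining minor along its last
  row. Using cofactors of A instead of its inverse keeps singular A covered, as needed at
  configurations with vanishing determinant.\<close>

lemma det_bordered:
  fixes M :: "'b :: comm_ring_1 mat"
  assumes M: "M \<in> carrier_mat (Suc k) (Suc k)"
  defines "A \<equiv> mat_delete M k k"
  shows "Determinant.det M = M $$ (k, k) * Determinant.det A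
    - (\<Sum>i<k. \<Sum>j<k. M $$ (i, k) * M $$ (k, j) * cofactor A i j)"
proof -
  have minor: "Determinant.det (mat_delete M i k) =
      (\<Sum>j<k. M $$ (k, j) * (-1) ^ (k - 1 + j) * Determinant.det (mat_delete A i j))"
    if i: "i < k" for i
  proof -
    have C: "mat_delete M i k \<in> carrier_mat k k"
      using mat_delete_carrier[OF M] by simp
    have "mat_delete M i k $$ (k - 1, j) * cofactor (mat_delete M i k) (k - 1) j
        = M $$ (k, j) * (-1) ^ (k - 1 + j) * Determinant.det (mat_delete A i j)"
      if j: "j < k" for j
    proof -
      \<comment> \<open>Since i < k, removing row i moves the last row of M up to position k -
        1.\<close>
      have "mat_delete M i k $$ (k - 1, j) = M $$ (k, j)"
        using i j M by (auto simp: mat_delete_def)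
      moreover have "mat_delete (mat_delete M i k) (k - 1) j = mat_delete A i j"
        using i j M unfolding A_def by (intro eq_matI) (auto simp: mat_delete_def)
      ultimately show ?thesis
        by (simp add: cofactor_def)
    qed
    then show ?thesis
      using i by (subst laplace_expansion_row[OF C, of "k - 1"]) auto
  qed
  have cof: "M $$ (i, k) * cofactor M i k
      = - (\<Sum>j<k. M $$ (i, k) * M $$ (k, j) * cofactor A i j)" if i: "i < k" for i
  proof -
    \<comment> \<open>The exponents of the two expansions add up to i + j plus an odd number; this
      is the origin of the minus sign.\<close>
    have sgn: "(-1) ^ (i + k) * (-1) ^ (k - 1 + j) = - ((-1 :: 'b) ^ (i + j))" for j
    proof -
      have "i + k + (k - 1 + j) = Suc (i + j) + 2 * (k - 1)"
        using i by simp
      then show ?thesis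
        by (simp only: power_add[symmetric]) (simp add: power_add)
    qed
    have "M $$ (i, k) * ((-1) ^ (i + k) *
        (M $$ (k, j) * (-1) ^ (k - 1 + j) * Determinant.det (mat_delete A i j)))
        = - (M $$ (i, k) * M $$ (k, j) * cofactor A i j)" for j
    proof -
      have "M $$ (i, k) * ((-1) ^ (i + k) *
          (M $$ (k, j) * (-1) ^ (k - 1 + j) * Determinant.det (mat_delete A i j)))
        = M $$ (i, k) * M $$ (k, j) * (((-1) ^ (i + k) * (-1) ^ (k - 1 + j)) *
            Determinant.det (mat_delete A i j))"
        by (simp only: mult_ac)
      then show ?thesis
        by (simp only: sgn) (simp add: cofactor_def)
    qed
    then show ?thesis
      unfolding cofactor_def[of M] minor[OF i] by (simp only: sum_distrib_left sum_negf)
  qed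
  have "Determinant.det M = (\<Sum>i<Suc k. M $$ (i, k) * cofactor M i k)"
    by (rule laplace_expansion_column[OF M]) simp
  also have "\<dots> = M $$ (k, k) * Determinant.det A + (\<Sum>i<k. M $$ (i, k) * cofactor M i k)"
    by (simp add: cofactor_def A_def add.commute)
  finally show ?thesis
    by (simp add: cof sum_negf)
qed

section \<open>Determinants of kernel matrices\<close>

lemma kernel_matrix_carrier [simp]: "kernel_matrix K k x \<in> carrier_mat k k"
  by (simp add: kernel_matrix_def)

lemma kernel_det_cong: "(\<And>i. i < k \<Longrightarrow> x i = y i) \<Longrightarrow> kernel_det K k x = kernel_det K k y"
  unfolding kernel_det_def kernel_matrix_def
  by (intro arg_cong[of _ _ Determinant.det] cong_mat) auto

lemma kernel_det_0 [simp]: "kernel_det K 0 x = 1"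
  by (simp add: kernel_det_def det_dim_zero[OF kernel_matrix_carrier])

lemma kernel_det_Suc:
  "kernel_det K (Suc k) (x(k := y)) = K y y * kernel_det K k x
    - (\<Sum>i<k. \<Sum>j<k. K (x i) y * K y (x j) * cofactor (kernel_matrix K k x) i j)"
proof -
  let ?M = "kernel_matrix K (Suc k) (x(k := y))"
  have "mat_delete ?M k k = kernel_matrix K k x"
    by (rule eq_matI) (auto simp: mat_delete_def kernel_matrix_def)
  then show ?thesis
    unfolding kernel_det_def by (subst det_bordered[of _ k]) (auto simp: kernel_matrix_def)
qed

text \<open>A polynomial in the kernel values, from which measurability is read off later.\<close>

lemma kernel_det_leibniz:
  "kernel_det K k x = (\<Sum>p | p permutes {0..<k}. signof p * (\<Prod>i = 0..<k. K (x i) (x (p i))))"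
proof -
  have "(\<Prod>i = 0..<k. kernel_matrix K k x $$ (i, p i)) = (\<Prod>i = 0..<k. K (x i) (x (p i)))"
    if "p permutes {0..<k}" for p
    using that permutes_in_image[OF that]
    by (intro prod.cong) (auto simp: kernel_matrix_def)
  then show ?thesis
    unfolding kernel_det_def by (subst det_def'[OF kernel_matrix_carrier]) simp
qed

section \<open>Inverse matrices and the Schur complement\<close>

lemma mat_inverse_adjugate:
  fixes A :: "'b :: field mat"
  assumes A: "A \<in> carrier_mat n n" and det: "Determinant.det A \<noteq> 0"
  shows "mat_inverse A = Some ((1 / Determinant.det A) \<cdot>\<^sub>m adj_mat A)"
proof -
  let ?B = "(1 / Determinant.det A) \<cdot>\<^sub>m adj_mat A"
  have B: "?B \<in> carrier_mat n n"
    using adj_mat(1)[OF A] by simp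
  have AB: "A * ?B = 1\<^sub>m n" and BA: "?B * A = 1\<^sub>m n"
    using adj_mat[OF A] A det
    by (auto simp: mult_smult_distrib[of _ n n _ n] mult_smult_assoc_mat[of _ n n _ n] intro!: eq_matI)
  \<comment> \<open>\<open>mat_inverse\<close> returns \<open>None\<close> only for non-units of the
    matrix ring; uniqueness of inverses then identifies its result with \<open>?B\<close>.\<close>
  have "A \<in> Units (ring_mat TYPE('b) n ())"
    using A B AB BA unfolding Units_def by (auto simp: ring_mat_def)
  then obtain C where C: "mat_inverse A = Some C"
    using mat_inverse(1)[OF A, of "()"] by (cases "mat_inverse A") auto
  then have "C * A = 1\<^sub>m n" "C \<in> carrier_mat n n"
    using mat_inverse(2)[OF A] by auto
  then have "C = C * (A * ?B)"
    by (simp add: AB)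
  also have "\<dots> = ?B"
    using A B \<open>C * A = 1\<^sub>m n\<close> \<open>C \<in> carrier_mat n n\<close>
    by (simp flip: assoc_mult_mat) (metis left_mult_one_mat smult_carrier_mat B)
  finally show ?thesis
    using C by simp
qed

lemma eta_next_density_eq_schur_density:
  assumes "kernel_det K k x \<noteq> 0"
  shows "eta_next_density K N k x y = schur_density K N k x y"
proof -
  let ?A = "kernel_matrix K k x"
  have inv: "mat_inverse ?A = Some ((1 / kernel_det K k x) \<cdot>\<^sub>m adj_mat ?A)"
    using assms mat_inverse_adjugate[OF kernel_matrix_carrier] by (simp add: kernel_det_def)
  have dims: "dim_row ?A = k" "dim_col ?A = k"
    by (simp_all add: kernel_matrix_def)
  have "scalar_prod (Matrix.vec k (\<lambda>i. K y (x i)))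
          (mult_mat_vec (the (mat_inverse ?A)) (Matrix.vec k (\<lambda>i. K (x i) y)))
      = (\<Sum>j<k. \<Sum>i<k. K (x i) y * K y (x j) * cofactor ?A i j) / kernel_det K k x"
    by (simp add: inv scalar_prod_def adj_mat_def dims lessThan_atLeast0 sum_distrib_left
        sum_divide_distrib mult_ac)
  \<comment> \<open>The sums are exchanged because the adjugate is the transposed cofactor
    matrix.\<close>
  also have "\<dots> = (\<Sum>i<k. \<Sum>j<k. K (x i) y * K y (x j) * cofactor ?A i j) / kernel_det K k x"
    by (subst sum.swap) (rule refl)
  finally show ?thesis
    using assms
    by (simp add: eta_next_density_def schur_density_def kernel_det_Suc diff_divide_distrib)
qed

section \<open>Kernel hypotheses, reality and positivity of determinants\<close>

lemma nn_integral_eq_has_bochner_integral: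
  fixes f :: "'b \<Rightarrow> real"
  assumes "has_bochner_integral M f c" and "\<And>x. x \<in> space M \<Longrightarrow> 0 \<le> f x"
  shows "(\<integral>\<^sup>+ x. ennreal (f x) \<partial>M) = ennreal c"
  using nn_integral_eq_integral[OF integrable.intros[OF assms(1)] AE_I2[OF assms(2)]]
  by (simp only: has_bochner_integral_integral_eq[OF assms(1)])

text \<open>Here \<open>\<nu>\<close> is the measure already restricted, so its space plays the role
  of \<open>\<Lambda>\<close>. Sigma-finiteness supplies Tonelli on its powers.\<close>

locale determinantal_kernel = sigma_finite_measure \<nu>
  for \<nu> :: "'a measure" and K :: "'a \<Rightarrow> 'a \<Rightarrow> complex" and N :: nat +
  assumes N_pos: "N \<ge> 1"
    and K_measurable [measurable]: "(\<lambda>(x, y). K x y) \<in> borel_measurable (\<nu> \<Otimes>\<^sub>M \<nu>)"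
    and pos_def: "positive_definite_kernel (space \<nu>) K"
    and trace: "has_bochner_integral \<nu> (\<lambda>x. K x x) (of_nat N)"
    and reproducing: "\<And>x y. x \<in> space \<nu> \<Longrightarrow> y \<in> space \<nu> \<Longrightarrow>
      has_bochner_integral \<nu> (\<lambda>u. K x u * K u y) (K x y)"
begin

sublocale product_sigma_finite "\<lambda>_ :: nat. \<nu>"
  by standard

abbreviation config :: "nat \<Rightarrow> (nat \<Rightarrow> 'a) measure" where
  "config k \<equiv> Pi\<^sub>M {..<k} (\<lambda>_. \<nu>)"

text \<open>Nothing is lost by taking real parts at points of the space: positive definiteness makes
  the determinant real there.\<close>

definition D :: "nat \<Rightarrow> (nat \<Rightarrow> 'a) \<Rightarrow> real" where
  "D k x = Re (kernel_det K k x)"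

lemma kernel_det_nonneg: "(\<And>i. i < k \<Longrightarrow> x i \<in> space \<nu>) \<Longrightarrow> 0 \<le> kernel_det K k x"
  using pos_def by (cases "k = 0") (auto simp: positive_definite_kernel_def less_eq_complex_def)

lemma kernel_det_eq_D: "(\<And>i. i < k \<Longrightarrow> x i \<in> space \<nu>) \<Longrightarrow> kernel_det K k x = of_real (D k x)"
  using kernel_det_nonneg[of k x] by (auto simp: D_def complex_eq_iff less_eq_complex_def)

lemma D_nonneg: "(\<And>i. i < k \<Longrightarrow> x i \<in> space \<nu>) \<Longrightarrow> 0 \<le> D k x"
  using kernel_det_nonneg[of k x] by (simp add: D_def less_eq_complex_def)

lemma D_0 [simp]: "D 0 x = 1"
  by (simp add: D_def)

lemma D_cong: "(\<And>i. i < k \<Longrightarrow> x i = y i) \<Longrightarrow> D k x = D k y"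
  unfolding D_def by (subst kernel_det_cong) auto

lemma kernel_det_pos_iff:
  "(\<And>i. i < k \<Longrightarrow> x i \<in> space \<nu>) \<Longrightarrow> 0 < kernel_det K k x \<longleftrightarrow> 0 < D k x"
  by (simp add: kernel_det_eq_D less_complex_def)

text \<open>The reproducing property turns K(x_i, y) K(y, x_j) into a matrix entry, so the double
  sum becomes k row expansions of one determinant, set against N copies from the trace.\<close>

lemma kernel_det_Suc_integral:
  assumes x: "\<And>i. i < k \<Longrightarrow> x i \<in> space \<nu>"
  shows "has_bochner_integral \<nu> (\<lambda>y. kernel_det K (Suc k) (x(k := y)))
    ((of_nat N - of_nat k) * kernel_det K k x)"
proof -
  let ?c = "cofactor (kernel_matrix K k x)"
  have "has_bochner_integral \<nu> (\<lambda>y. K (x i) y * K y (x j) * ?c i j) (K (x i) (x j) * ?c i j)"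
    if "i < k" "j < k" for i j
    using that x by (intro has_bochner_integral_mult_left reproducing) auto
  then have "has_bochner_integral \<nu> (\<lambda>y. kernel_det K (Suc k) (x(k := y)))
    (of_nat N * kernel_det K k x - (\<Sum>i<k. \<Sum>j<k. K (x i) (x j) * ?c i j))"
    unfolding kernel_det_Suc
    by (intro has_bochner_integral_diff[OF has_bochner_integral_mult_left[OF trace]]
        has_bochner_integral_sum) auto
  moreover have "(\<Sum>j<k. K (x i) (x j) * ?c i j) = kernel_det K k x" if "i < k" for i
    using laplace_expansion_row[OF kernel_matrix_carrier that, of K x] that
    by (simp add: kernel_det_def) (simp add: kernel_matrix_def)
  ultimately show ?thesis
    by (simp add: algebra_simps)
qed

section \<open>Measurability and Tonelli on configurations\<close>

lemma space_config: "x \<in> space (config k) \<Longrightarrow> i < k \<Longrightarrow> x i \<in> space \<nu>"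
  by (auto simp: space_PiM)

text \<open>Allowing k \<le> m lets determinants of all initial segments be compared on one
  configuration space.\<close>

lemma kernel_det_measurable [measurable]:
  assumes "k \<le> m"
  shows "kernel_det K k \<in> borel_measurable (config m)"
proof -
  have [measurable]: "(\<lambda>x. K (x i) (x j)) \<in> borel_measurable (config m)" if "i < k" "j < k" for i j
  proof -
    have [measurable]: "(\<lambda>x. x i) \<in> config m \<rightarrow>\<^sub>M \<nu>" "(\<lambda>x. x j) \<in> config m \<rightarrow>\<^sub>M \<nu>"
      using that assms by (auto intro!: measurable_component_singleton)
    show ?thesis
      by measurable
  qed
  have "(\<lambda>x. \<Sum>p | p permutes {0..<k}. signof p * (\<Prod>i = 0..<k. K (x i) (x (p i))))
      \<in> borel_measurable (config m)"
    using permutes_in_image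
    by (intro borel_measurable_sum borel_measurable_times borel_measurable_prod) fastforce+
  then show ?thesis
    by (simp add: kernel_det_leibniz[abs_def])
qed

lemma D_measurable [measurable]: "k \<le> m \<Longrightarrow> D k \<in> borel_measurable (config m)"
  unfolding D_def by measurable

lemma fun_upd_measurable [measurable]:
  "(\<lambda>(x, y). x(k := y)) \<in> config k \<Otimes>\<^sub>M \<nu> \<rightarrow>\<^sub>M config (Suc k)"
  using measurable_add_dim[of k "{..<k}" "\<lambda>_. \<nu>"] by (simp add: lessThan_Suc)

lemma fun_upd_measurable' [measurable]:
  "x \<in> space (config k) \<Longrightarrow> (\<lambda>y. x(k := y)) \<in> \<nu> \<rightarrow>\<^sub>M config (Suc k)"
  using measurable_Pair2[OF fun_upd_measurable, of x k] by simp

lemma nn_integral_config_Suc: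
  "f \<in> borel_measurable (config (Suc k)) \<Longrightarrow>
    (\<integral>\<^sup>+ x. f x \<partial>config (Suc k)) = (\<integral>\<^sup>+ x. \<integral>\<^sup>+ y. f (x(k := y)) \<partial>\<nu> \<partial>config k)"
  using product_nn_integral_insert[of "{..<k}" k f] by (simp add: lessThan_Suc)

section \<open>Integrating out the last point, and null sets\<close>

lemma has_bochner_integral_D_Suc:
  assumes "\<And>i. i < k \<Longrightarrow> x i \<in> space \<nu>" and "k \<le> N"
  shows "has_bochner_integral \<nu> (\<lambda>y. D (Suc k) (x(k := y))) (real (N - k) * D k x)"
proof -
  have "has_bochner_integral \<nu> (\<lambda>y. D (Suc k) (x(k := y)))
      (Re ((of_nat N - of_nat k) * kernel_det K k x))"
    unfolding D_def using kernel_det_Suc_integral[OF assms(1)]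
    by (rule has_bochner_integral_bounded_linear[OF bounded_linear_Re])
  also have "Re ((of_nat N - of_nat k) * kernel_det K k x) = real (N - k) * D k x"
    using \<open>k \<le> N\<close> by (simp add: D_def of_nat_diff)
  finally show ?thesis .
qed

lemma D_Suc_nonneg:
  "(\<And>i. i < k \<Longrightarrow> x i \<in> space \<nu>) \<Longrightarrow> y \<in> space \<nu> \<Longrightarrow> 0 \<le> D (Suc k) (x(k := y))"
  by (intro D_nonneg) auto

text \<open>A nonnegative function whose integral, a multiple of \<open>D k x\<close>, is
  zero.\<close>

lemma AE_D_Suc_eq_0:
  assumes x: "x \<in> space (config k)" and "k \<le> N" "D k x = 0"
  shows "AE y in \<nu>. D (Suc k) (x(k := y)) = 0"
proof -
  have [measurable]: "(\<lambda>y. D (Suc k) (x(k := y))) \<in> borel_measurable \<nu>"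
    by (rule measurable_compose[OF fun_upd_measurable'[OF x] D_measurable]) simp
  have "(\<integral>\<^sup>+ y. ennreal (D (Suc k) (x(k := y))) \<partial>\<nu>) = 0"
    using nn_integral_eq_has_bochner_integral[OF has_bochner_integral_D_Suc[OF space_config[OF x]]]
      D_Suc_nonneg[OF space_config[OF x]] assms by simp
  then have "AE y in \<nu>. ennreal (D (Suc k) (x(k := y))) = 0"
    by (subst (asm) nn_integral_0_iff_AE) auto
  moreover have "D (Suc k) (x(k := y)) \<ge> 0" if "y \<in> space \<nu>" for y
    using that by (intro D_Suc_nonneg space_config[OF x])
  ultimately show ?thesis
    using AE_space by (auto simp: ennreal_eq_0_iff intro: antisym elim!: eventually_elim2)
qed

text \<open>K need not be Hermitian, so the argument goes through integration over the last point
  and yields an almost everywhere statement, by induction on the length.\<close>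

lemma AE_D_pos: "j \<le> N \<Longrightarrow> AE x in config j. 0 < D j x \<longrightarrow> (\<forall>k\<le>j. 0 < D k x)"
proof (induction j)
  case 0
  then show ?case by simp
next
  case (Suc j)
  let ?P = "\<lambda>x. 0 < D (Suc j) x \<longrightarrow> (\<forall>k\<le>Suc j. 0 < D k x)"
  let ?S = "{x \<in> space (config (Suc j)). \<not> ?P x}"
  have "?S = {x \<in> space (config (Suc j)). 0 < D (Suc j) x} -
      (\<Inter>k\<in>{..Suc j}. {x \<in> space (config (Suc j)). 0 < D k x})"
    by auto
  also have "\<dots> \<in> sets (config (Suc j))"
    by (intro sets.Diff sets.finite_INT) auto
  finally have [measurable]: "?S \<in> sets (config (Suc j))" .
  have "AE y in \<nu>. ?P (x(j := y))"
    if x: "x \<in> space (config j)" and px: "0 < D j x \<longrightarrow> (\<forall>k\<le>j. 0 < D k x)" for x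
  proof (cases "D j x = 0")
    \<comment> \<open>For almost every y the new determinant vanishes too, so the implication is
      vacuous.\<close>
    case True
    then show ?thesis
      using AE_D_Suc_eq_0[OF x _ True] Suc.prems by auto
  next
    case False
    then have "0 < D j x"
      using D_nonneg[OF space_config[OF x]] by (simp add: less_le)
    \<comment> \<open>Determinants of order at most j do not see the appended point.\<close>
    moreover have "D k (x(j := y)) = D k x" if "k \<le> j" for k y
      using that by (intro D_cong) auto
    ultimately show ?thesis
      using px by (auto simp: le_Suc_eq)
  qed
  note step = this
  have "AE x in config j. 0 < D j x \<longrightarrow> (\<forall>k\<le>j. 0 < D k x)"
    using Suc by simp
  with AE_space have "AE x in config j. AE y in \<nu>. ?P (x(j := y))"
    by eventually_elim (rule step)
  \<comment> \<open>Almost every section of the exceptional set is null, so Tonelli makes the set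
    itself null.\<close>
  then have "AE x in config j. (\<integral>\<^sup>+ y. indicator ?S (x(j := y)) \<partial>\<nu>) = 0"
  proof (rule AE_mp, intro AE_I2 impI)
    fix x assume x: "x \<in> space (config j)" and "AE y in \<nu>. ?P (x(j := y))"
    then have "(\<integral>\<^sup>+ y. indicator ?S (x(j := y)) \<partial>\<nu>) = (\<integral>\<^sup>+ y. 0 \<partial>\<nu>)"
      by (intro nn_integral_cong_AE) (auto elim!: eventually_mono simp: indicator_def)
    then show "(\<integral>\<^sup>+ y. indicator ?S (x(j := y)) \<partial>\<nu>) = 0"
      by simp
  qed
  then have "(\<integral>\<^sup>+ x. \<integral>\<^sup>+ y. indicator ?S (x(j := y)) \<partial>\<nu> \<partial>config j) = (\<integral>\<^sup>+ x. 0 \<partial>config j)"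
    by (intro nn_integral_cong_AE) auto
  note zero = this
  have "emeasure (config (Suc j)) ?S = (\<integral>\<^sup>+ x. indicator ?S x \<partial>config (Suc j))"
    by (rule nn_integral_indicator[symmetric]) fact
  also have "\<dots> = (\<integral>\<^sup>+ x. \<integral>\<^sup>+ y. indicator ?S (x(j := y)) \<partial>\<nu> \<partial>config j)"
    by (rule nn_integral_config_Suc) measurable
  also have "\<dots> = (\<integral>\<^sup>+ x. 0 \<partial>config j)"
    by (rule zero)
  finally have "emeasure (config (Suc j)) ?S = 0"
    by simp
  then show ?case
    by (intro AE_I[of _ _ ?S]) auto
qed

section \<open>Conditional laws\<close>

text \<open>One formula for all sampling laws: since \<open>D 0 x = 1\<close>, it gives the first
  law at k = 0. The value 0 matches the null measure in \<open>eta_next\<close>.\<close>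

definition cond_density :: "nat \<Rightarrow> (nat \<Rightarrow> 'a) \<Rightarrow> 'a \<Rightarrow> real" where
  "cond_density k x y = (if 0 < D k x then D (Suc k) (x(k := y)) / (real (N - k) * D k x) else 0)"

lemma cond_density_nonneg:
  "(\<And>i. i < k \<Longrightarrow> x i \<in> space \<nu>) \<Longrightarrow> y \<in> space \<nu> \<Longrightarrow> 0 \<le> cond_density k x y"
  using D_Suc_nonneg[of k x y] by (simp add: cond_density_def)

lemma cond_density_measurable [measurable]: "(\<lambda>(x, y). cond_density k x y) \<in> borel_measurable (config k \<Otimes>\<^sub>M \<nu>)"
proof -
  have [measurable]: "(\<lambda>(x, y). D (Suc k) (x(k := y))) \<in> borel_measurable (config k \<Otimes>\<^sub>M \<nu>)"
    using measurable_compose[OF fun_upd_measurable D_measurable[of "Suc k" "Suc k"]]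
    by (simp add: case_prod_beta')
  have [measurable]: "D k \<in> borel_measurable (config k)"
    by simp
  show ?thesis
    unfolding cond_density_def by measurable
qed

lemma eta_next_density_eq_cond_density:
  assumes x: "\<And>i. i < k \<Longrightarrow> x i \<in> space \<nu>" and k: "k < N"
    and "0 < kernel_det K k x" and y: "y \<in> space \<nu>"
  shows "eta_next_density K N k x y = of_real (cond_density k x y)"
proof -
  have "0 < D k x"
    using assms by (simp add: kernel_det_pos_iff)
  moreover have "kernel_det K (k + 1) (x(k := y)) = of_real (D (Suc k) (x(k := y)))"
    using x y kernel_det_eq_D[of "Suc k" "x(k := y)"] by simp
  moreover have "kernel_det K k x = of_real (D k x)"
    by (rule kernel_det_eq_D[OF x])
  ultimately show ?thesis
    using k by (simp add: eta_next_density_def cond_density_def of_nat_diff)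
qed

lemma eta_eq_density:
  assumes x: "\<And>i. i < k \<Longrightarrow> x i \<in> space \<nu>" and k: "k < N"
  shows "eta \<nu> K N k x = density \<nu> (\<lambda>y. ennreal (cond_density k x y))"
proof -
  have next_eq: "eta_next \<nu> K N k x = density \<nu> (\<lambda>y. ennreal (cond_density k x y))"
  proof (cases "0 < kernel_det K k x")
    case True
    then have "Re (eta_next_density K N k x y) = cond_density k x y" if "y \<in> space \<nu>" for y
      using eta_next_density_eq_cond_density[OF x k True that] by simp
    moreover have "eta_next \<nu> K N k x = density \<nu> (\<lambda>y. ennreal (Re (eta_next_density K N k x y)))"
      using True by (simp add: eta_next_def)
    \<comment> \<open>The densities are known to agree only on the space of \<open>\<nu>\<close>,
      which suffices because \<open>density\<close> integrates over that space.\<close>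
    ultimately show ?thesis
      by (simp add: density_def cong: nn_integral_cong)
  next
    case False
    then have "\<not> 0 < D k x"
      using x by (simp add: kernel_det_pos_iff)
    with False show ?thesis
      by (simp add: eta_next_def cond_density_def null_measure_eq_density)
  qed
  have "kernel_det K (Suc 0) (x(0 := y)) = K y y" for y
    by (simp add: kernel_det_Suc)
  then have "D (Suc 0) (x(0 := y)) = Re (K y y)" for y
    by (simp add: D_def)
  then have "eta_first \<nu> K N = density \<nu> (\<lambda>y. ennreal (cond_density 0 x y))"
    by (simp add: eta_first_def cond_density_def)
  with next_eq show ?thesis
    by (simp add: eta_def)
qed

text \<open>The normaliser is exactly the integral of the bordered determinant.\<close>

lemma prob_space_eta:
  assumes x: "\<And>i. i < k \<Longrightarrow> x i \<in> space \<nu>" and k: "k < N" and pos: "0 < D k x"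
  shows "prob_space (eta \<nu> K N k x)"
proof (rule prob_spaceI)
  have "has_bochner_integral \<nu> (\<lambda>y. D (Suc k) (x(k := y)) / (real (N - k) * D k x))
      (real (N - k) * D k x / (real (N - k) * D k x))"
    using x k by (intro has_bochner_integral_divide_zero has_bochner_integral_D_Suc) auto
  then have I: "has_bochner_integral \<nu> (cond_density k x) 1"
    using k pos by (simp add: cond_density_def[abs_def])
  have "emeasure (eta \<nu> K N k x) (space \<nu>) = (\<integral>\<^sup>+ y. ennreal (cond_density k x y) \<partial>\<nu>)"
    using borel_measurable_has_bochner_integral[OF I]
    by (simp add: eta_eq_density[OF x k] emeasure_density cong: nn_integral_cong)
  also have "\<dots> = 1"
    using nn_integral_eq_has_bochner_integral[OF I cond_density_nonneg[OF x]] by simp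
  finally show "emeasure (eta \<nu> K N k x) (space (eta \<nu> K N k x)) = 1"
    by (simp add: eta_eq_density[OF x k])
qed

text \<open>On an empty space the trace would be 0 and not N. Subprobability measures and the Giry
  bind below rely on nonemptiness.\<close>

lemma space_nonempty: "space \<nu> \<noteq> {}"
proof
  assume "space \<nu> = {}"
  then have "integral\<^sup>L \<nu> (\<lambda>x. K x x) = 0"
    by (simp add: Bochner_Integration.integral_empty)
  then show False
    using has_bochner_integral_integral_eq[OF trace] N_pos by simp
qed

text \<open>A Giry kernel must be a subprobability at every configuration, including those where
  \<open>eta\<close> is the null measure.\<close>

lemma subprob_space_eta:
  assumes x: "\<And>i. i < k \<Longrightarrow> x i \<in> space \<nu>" and k: "k < N"
  shows "subprob_space (eta \<nu> K N k x)"
proof (cases "0 < D k x")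
  case True
  then show ?thesis
    using prob_space_eta[OF x k] by (simp add: prob_space_imp_subprob_space)
next
  case False
  then show ?thesis
    using space_nonempty by (intro subprob_spaceI) (auto simp: eta_eq_density[OF x k] cond_density_def emeasure_density)
qed

lemma sets_eta [simp]: "sets (eta \<nu> K N k x) = sets \<nu>"
  by (simp add: eta_def eta_first_def eta_next_def)

lemma nn_integral_eta:
  assumes x: "x \<in> space (config k)" and k: "k < N" and g [measurable]: "g \<in> borel_measurable (config (Suc k))"
  shows "(\<integral>\<^sup>+ y. g (x(k := y)) \<partial>eta \<nu> K N k x) = (\<integral>\<^sup>+ y. ennreal (cond_density k x y) * g (x(k := y)) \<partial>\<nu>)"
proof -
  have [measurable]: "cond_density k x \<in> borel_measurable \<nu>"
    using measurable_Pair2[OF cond_density_measurable x] by simp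
  have [measurable]: "(\<lambda>y. g (x(k := y))) \<in> borel_measurable \<nu>"
    by (rule measurable_compose[OF fun_upd_measurable'[OF x] g])
  show ?thesis
    by (subst eta_eq_density) (auto simp: k space_config[OF x] nn_integral_density)
qed

lemma nn_integral_eta_measurable:
  assumes k: "k < N" and g [measurable]: "g \<in> borel_measurable (config (Suc k))"
  shows "(\<lambda>x. \<integral>\<^sup>+ y. g (x(k := y)) \<partial>eta \<nu> K N k x) \<in> borel_measurable (config k)"
proof -
  have [measurable]: "(\<lambda>(x, y). g (x(k := y))) \<in> borel_measurable (config k \<Otimes>\<^sub>M \<nu>)"
    using measurable_compose[OF fun_upd_measurable g] by (simp add: case_prod_beta')
  have "(\<lambda>x. \<integral>\<^sup>+ y. ennreal (cond_density k x y) * g (x(k := y)) \<partial>\<nu>) \<in> borel_measurable (config k)"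
    by measurable
  then show ?thesis
    using k by (subst measurable_cong[OF nn_integral_eta]) auto
qed

section \<open>Telescoping densities\<close>

text \<open>Interpolates between the constant 1 at k = 0 and the density of
  \<open>determinantal_law\<close> at k = N.\<close>

definition weight :: "nat \<Rightarrow> (nat \<Rightarrow> 'a) \<Rightarrow> real" where
  "weight k x = D k x * fact (N - k) / fact N"

lemma weight_measurable [measurable]: "weight k \<in> borel_measurable (config k)"
proof -
  have [measurable]: "D k \<in> borel_measurable (config k)"
    by simp
  show ?thesis
    unfolding weight_def[abs_def] by measurable
qed

text \<open>The chain rule for densities. Where \<open>D k x = 0\<close> the left side is 0 and the
  right side vanishes for almost every y only.\<close>

lemma AE_weight_Suc:
  assumes x: "x \<in> space (config k)" and k: "k < N"
  shows "AE y in \<nu>. weight k x * cond_density k x y = weight (Suc k) (x(k := y))"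
proof (cases "D k x = 0")
  case True
  then show ?thesis
    using AE_D_Suc_eq_0[OF x _ True] k by (auto simp: weight_def)
next
  case False
  then have "0 < D k x"
    using D_nonneg[OF space_config[OF x]] by (simp add: less_le)
  \<comment> \<open>The factor N - k split off the factorial cancels the normaliser of the
    conditional density.\<close>
  moreover have "fact (N - k) = real (N - k) * fact (N - Suc k)"
    using k by (simp add: fact_reduce)
  ultimately show ?thesis
    using k by (simp add: weight_def cond_density_def)
qed

text \<open>One telescoping step. It is applied with g an iterated integral, the constant 1 and an
  indicator function.\<close>

lemma nn_integral_weight_Suc:
  assumes k: "k < N" and g [measurable]: "g \<in> borel_measurable (config (Suc k))"
  shows "(\<integral>\<^sup>+ x. ennreal (weight k x) * (\<integral>\<^sup>+ y. g (x(k := y)) \<partial>eta \<nu> K N k x) \<partial>config k)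
    = (\<integral>\<^sup>+ x. ennreal (weight (Suc k) x) * g x \<partial>config (Suc k))"
proof -
  have "ennreal (weight k x) * (\<integral>\<^sup>+ y. g (x(k := y)) \<partial>eta \<nu> K N k x)
      = (\<integral>\<^sup>+ y. ennreal (weight (Suc k) (x(k := y))) * g (x(k := y)) \<partial>\<nu>)"
    if x: "x \<in> space (config k)" for x
  proof -
    have [measurable]: "cond_density k x \<in> borel_measurable \<nu>"
      using measurable_Pair2[OF cond_density_measurable x] by simp
    have [measurable]: "(\<lambda>y. g (x(k := y))) \<in> borel_measurable \<nu>"
      by (rule measurable_compose[OF fun_upd_measurable'[OF x] g])
    have "0 \<le> weight k x"
      using D_nonneg[OF space_config[OF x]] by (simp add: weight_def)
    then have "ennreal (weight k x) * (\<integral>\<^sup>+ y. g (x(k := y)) \<partial>eta \<nu> K N k x)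
        = (\<integral>\<^sup>+ y. ennreal (weight k x * cond_density k x y) * g (x(k := y)) \<partial>\<nu>)"
      by (simp add: nn_integral_eta[OF x k g] ennreal_mult' mult.assoc nn_integral_cmult)
    also have "\<dots> = (\<integral>\<^sup>+ y. ennreal (weight (Suc k) (x(k := y))) * g (x(k := y)) \<partial>\<nu>)"
      using AE_weight_Suc[OF x k] by (intro nn_integral_cong_AE) (auto elim!: eventually_mono)
    finally show ?thesis .
  qed
  then have "(\<integral>\<^sup>+ x. ennreal (weight k x) * (\<integral>\<^sup>+ y. g (x(k := y)) \<partial>eta \<nu> K N k x) \<partial>config k)
      = (\<integral>\<^sup>+ x. \<integral>\<^sup>+ y. ennreal (weight (Suc k) (x(k := y))) * g (x(k := y)) \<partial>\<nu> \<partial>config k)"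
    by (intro nn_integral_cong)
  also have "\<dots> = (\<integral>\<^sup>+ x. ennreal (weight (Suc k) x) * g x \<partial>config (Suc k))"
    by (rule nn_integral_config_Suc[symmetric]) measurable
  finally show ?thesis .
qed

text \<open>The empty product is a unit mass at \<open>\<lambda>_. undefined\<close>, where both the
  iterated integral and the sampling start.\<close>

lemma nn_integral_PiM_empty: "(\<integral>\<^sup>+ x. f x \<partial>Pi\<^sub>M {} (\<lambda>_. \<nu>)) = f (\<lambda>_. undefined)"
  by (simp add: PiM_empty nn_integral_count_space_finite)

lemma weight_0 [simp]: "weight 0 x = 1"
  by (simp add: weight_def)

section \<open>Iterated integrals and the determinantal law\<close>

lemma iterated_integral_measurable:
  assumes f: "f \<in> borel_measurable (config N)"
  shows "n + k = N \<Longrightarrow> (\<lambda>x. iterated_integral \<nu> K N n k x f) \<in> borel_measurable (config k)"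
proof (induction n arbitrary: k)
  case 0
  then show ?case using f by simp
next
  case (Suc n)
  then show ?case
    using nn_integral_eta_measurable[of k "\<lambda>x. iterated_integral \<nu> K N n (Suc k) x f"] by simp
qed

text \<open>The left side does not depend on k: at k = N it is the weighted integral of f, at k = 0
  the full iterated integral.\<close>

lemma nn_integral_weight_iterated_integral:
  assumes f: "f \<in> borel_measurable (config N)"
  shows "n + k = N \<Longrightarrow> (\<integral>\<^sup>+ x. ennreal (weight k x) * iterated_integral \<nu> K N n k x f \<partial>config k)
    = (\<integral>\<^sup>+ x. ennreal (weight N x) * f x \<partial>config N)"
proof (induction n arbitrary: k)
  case 0
  then show ?case by simp
next
  case (Suc n)
  then show ?case
    using nn_integral_weight_Suc[OF _ iterated_integral_measurable[OF f, of n "Suc k"]] by simp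
qed

lemma determinantal_law_eq: "determinantal_law \<nu> K N = density (config N) (\<lambda>x. ennreal (weight N x))"
  by (simp add: determinantal_law_def weight_def D_def)

lemma nn_integral_determinantal_law:
  assumes f: "f \<in> borel_measurable (config N)"
  shows "(\<integral>\<^sup>+ x. f x \<partial>determinantal_law \<nu> K N) = iterated_integral \<nu> K N N 0 (\<lambda>_. undefined) f"
proof -
  have "(\<integral>\<^sup>+ x. f x \<partial>determinantal_law \<nu> K N) = (\<integral>\<^sup>+ x. ennreal (weight N x) * f x \<partial>config N)"
    unfolding determinantal_law_eq using f by (intro nn_integral_density) measurable
  then show ?thesis
    using nn_integral_weight_iterated_integral[OF f, of N 0] by (simp add: nn_integral_PiM_empty)
qed

lemma nn_integral_weight: "k \<le> N \<Longrightarrow> (\<integral>\<^sup>+ x. ennreal (weight k x) \<partial>config k) = 1"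
proof (induction k)
  case 0
  then show ?case by (simp add: nn_integral_PiM_empty del: nn_integral_const)
next
  case (Suc k)
  have "ennreal (weight k x) * (\<integral>\<^sup>+ y. 1 \<partial>eta \<nu> K N k x) = ennreal (weight k x)"
    if x: "x \<in> space (config k)" for x
  proof (cases "0 < D k x")
    case True
    then show ?thesis
      using prob_space.emeasure_space_1[OF prob_space_eta[OF space_config[OF x]]] Suc.prems by simp
  next
    case False
    \<comment> \<open>Here \<open>eta\<close> has mass 0, which is harmless because the weight
      vanishes too.\<close>
    then have "D k x = 0"
      using D_nonneg[OF space_config[OF x]] by (simp add: less_le)
    then show ?thesis
      by (simp add: weight_def)
  qed
  then have "(\<integral>\<^sup>+ x. ennreal (weight k x) * (\<integral>\<^sup>+ y. 1 \<partial>eta \<nu> K N k x) \<partial>config k) = 1"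
    using Suc by (simp cong: nn_integral_cong)
  then show ?case
    using nn_integral_weight_Suc[of k "\<lambda>_. 1"] Suc.prems by simp
qed

lemma prob_space_determinantal_law: "prob_space (determinantal_law \<nu> K N)"
  by (rule prob_spaceI)
    (simp add: determinantal_law_eq emeasure_density nn_integral_weight cong: nn_integral_cong)

text \<open>The law charges only configurations with positive weight, that is
  \<open>0 < D N x\<close>, and \<open>AE_D_pos\<close> descends from order N.\<close>

lemma AE_determinantal_law_pos:
  "AE x in determinantal_law \<nu> K N. \<forall>k\<in>{1..N}. 0 < kernel_det K k x"
proof -
  have "AE x in config N. 0 < weight N x \<longrightarrow> (\<forall>k\<in>{1..N}. 0 < kernel_det K k x)"
    using AE_D_pos[OF order_refl] AE_space
  proof eventually_elim
    case (elim x)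
    then show ?case
      using space_config[of x N] by (auto simp: weight_def kernel_det_pos_iff zero_less_divide_iff)
  qed
  then show ?thesis
    unfolding determinantal_law_eq by (subst AE_density) auto
qed

section \<open>The sequential sampling law\<close>

lemma space_config_nonempty: "space (config k) \<noteq> {}"
  using space_nonempty by (simp add: space_PiM PiE_eq_empty_iff)

lemma sequential_law_eq: "k \<le> N \<Longrightarrow> sequential_law \<nu> K N k = density (config k) (\<lambda>x. ennreal (weight k x))"
proof (induction k)
  case 0
  show ?case
  proof (rule measure_eqI)
    fix A assume "A \<in> sets (sequential_law \<nu> K N 0)"
    then have "A \<in> sets (config 0)"
      by simp
    then show "emeasure (sequential_law \<nu> K N 0) A = emeasure (density (config 0) (\<lambda>x. ennreal (weight 0 x))) A"
      by (simp add: emeasure_density nn_integral_PiM_empty)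
  qed simp
next
  case (Suc k)
  let ?S = "density (config k) (\<lambda>x. ennreal (weight k x))"
  let ?f = "\<lambda>x. distr (eta \<nu> K N k x) (config (Suc k)) (\<lambda>y. x(k := y))"
  have k: "k < N"
    using Suc.prems by simp
  have meas: "(\<lambda>y. x(k := y)) \<in> eta \<nu> K N k x \<rightarrow>\<^sub>M config (Suc k)" if "x \<in> space (config k)" for x
    using fun_upd_measurable'[OF that] by (simp add: measurable_cong_sets[OF sets_eta refl])
  \<comment> \<open>Puts the pushforward in the form of an \<open>eta\<close>-integral, to which the
    telescoping step applies.\<close>
  have em: "emeasure (?f x) A = (\<integral>\<^sup>+ y. indicator A (x(k := y)) \<partial>eta \<nu> K N k x)"
    if "x \<in> space (config k)" "A \<in> sets (config (Suc k))" for x A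
    using that meas[OF that(1)]
    by (subst nn_integral_distr[symmetric, where T = "\<lambda>y. x(k := y)" and M' = "config (Suc k)"]) auto
  \<comment> \<open>Measurability as a Giry kernel is what allows \<open>emeasure_bind\<close> to
    compute the bind.\<close>
  have "?f \<in> config k \<rightarrow>\<^sub>M subprob_algebra (config (Suc k))"
  proof (rule measurable_subprob_algebra)
    fix x assume "x \<in> space (config k)"
    then show "subprob_space (?f x)"
      using k subprob_space_eta[OF space_config] meas space_config_nonempty
      by (intro subprob_space.subprob_space_distr) auto
  next
    fix A assume "A \<in> sets (config (Suc k))"
    then show "(\<lambda>x. emeasure (?f x) A) \<in> borel_measurable (config k)"
      using k by (subst measurable_cong[OF em]) (auto intro!: nn_integral_eta_measurable)
  qed simp
  then have f: "?f \<in> ?S \<rightarrow>\<^sub>M subprob_algebra (config (Suc k))"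
    by simp
  have ne: "space ?S \<noteq> {}"
    using space_config_nonempty by simp
  show ?case
  proof (rule measure_eqI)
    have seq: "sequential_law \<nu> K N (Suc k) = ?S \<bind> ?f"
      using Suc by simp
    show "sets (sequential_law \<nu> K N (Suc k)) = sets (density (config (Suc k)) (\<lambda>x. ennreal (weight (Suc k) x)))"
      unfolding seq using sets_bind[OF sets_kernel[OF f] ne] by simp
    then show "emeasure (sequential_law \<nu> K N (Suc k)) A
        = emeasure (density (config (Suc k)) (\<lambda>x. ennreal (weight (Suc k) x))) A"
      if "A \<in> sets (sequential_law \<nu> K N (Suc k))" for A
    proof -
      assume "sets (sequential_law \<nu> K N (Suc k)) = sets (density (config (Suc k)) (\<lambda>x. ennreal (weight (Suc k) x)))"
      with that have A [measurable]: "A \<in> sets (config (Suc k))"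
        by simp
      have [measurable]: "(\<lambda>x. \<integral>\<^sup>+ y. indicator A (x(k := y)) \<partial>eta \<nu> K N k x) \<in> borel_measurable (config k)"
        using k by (intro nn_integral_eta_measurable) auto
      have "emeasure (?S \<bind> ?f) A = (\<integral>\<^sup>+ x. emeasure (?f x) A \<partial>?S)"
        by (rule emeasure_bind[OF ne f A])
      also have "\<dots> = (\<integral>\<^sup>+ x. \<integral>\<^sup>+ y. indicator A (x(k := y)) \<partial>eta \<nu> K N k x \<partial>?S)"
        by (intro nn_integral_cong em A) simp
      also have "\<dots> = (\<integral>\<^sup>+ x. ennreal (weight k x) * (\<integral>\<^sup>+ y. indicator A (x(k := y)) \<partial>eta \<nu> K N k x) \<partial>config k)"
        by (rule nn_integral_density) measurable
      also have "\<dots> = (\<integral>\<^sup>+ x. ennreal (weight (Suc k) x) * indicator A x \<partial>config (Suc k))"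
        using k by (intro nn_integral_weight_Suc) auto
      also have "\<dots> = emeasure (density (config (Suc k)) (\<lambda>x. ennreal (weight (Suc k) x))) A"
        by (rule emeasure_density[symmetric]) measurable
      finally show ?thesis
        unfolding seq .
    qed
  qed
qed

end

section \<open>Sequential sampling for the measure restricted to its support\<close>

theorem mainTheorem7:
  fixes \<mu> \<nu> :: "'a measure" and \<Lambda> :: "'a set" and K :: "'a \<Rightarrow> 'a \<Rightarrow> complex" and N :: nat
  assumes "sigma_finite_measure \<mu>"
    and "\<Lambda> \<in> sets \<mu>" and "emeasure \<mu> (space \<mu> - \<Lambda>) = 0"
    and "\<nu> = restrict_space \<mu> \<Lambda>"
    and "N \<ge> 1"
    and "(\<lambda>(x, y). K x y) \<in> borel_measurable (\<nu> \<Otimes>\<^sub>M \<nu>)"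
    and "positive_definite_kernel \<Lambda> K"
    and "has_bochner_integral \<nu> (\<lambda>x. K x x) (of_nat N)"
    and "\<forall>x\<in>\<Lambda>. \<forall>y\<in>\<Lambda>. has_bochner_integral \<nu> (\<lambda>u. K x u * K u y) (K x y)"
  shows "prob_space (determinantal_law \<nu> K N)
    \<and> (AE x in determinantal_law \<nu> K N. \<forall>k\<in>{1..N}. 0 < kernel_det K k x)
    \<and> prob_space (eta_first \<nu> K N)
    \<and> (\<forall>k\<in>{1..N-1}. \<forall>x. (\<forall>i<k. x i \<in> \<Lambda>) \<and> 0 < kernel_det K k x
           \<longrightarrow> prob_space (eta_next \<nu> K N k x))
    \<and> (\<forall>f\<in>borel_measurable (Pi\<^sub>M {..<N} (\<lambda>_. \<nu>)).
           (\<integral>\<^sup>+ x. f x \<partial>determinantal_law \<nu> K N)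
             = iterated_integral \<nu> K N N 0 (\<lambda>_. undefined) f)
    \<and> sequential_law \<nu> K N N = determinantal_law \<nu> K N
    \<and> (\<forall>k\<in>{1..N-1}. \<forall>x. (\<forall>i<k. x i \<in> \<Lambda>) \<and> 0 < kernel_det K k x
           \<longrightarrow> mat_inverse (kernel_matrix K k x) \<noteq> None
             \<and> (\<forall>y\<in>\<Lambda>. 0 \<le> schur_density K N k x y
                  \<and> eta_next_density K N k x y = schur_density K N k x y)
             \<and> eta_next \<nu> K N k x = density \<nu> (\<lambda>y. ennreal (Re (schur_density K N k x y))))"
proof -
  \<comment> \<open>Identifies conditions over the space of \<open>\<nu>\<close> with conditions
    over \<open>\<Lambda>\<close>.\<close>
  have space: "space \<nu> = \<Lambda>"
    using assms(2,4) sets.sets_into_space[OF assms(2)] by (auto simp: space_restrict_space)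
  interpret determinantal_kernel \<nu> K N
    using assms sigma_finite_measure_restrict_space[OF assms(1,2)]
    by (intro determinantal_kernel.intro determinantal_kernel_axioms.intro) (auto simp: space)
  have eta_next_prob: "prob_space (eta_next \<nu> K N k x)"
    if "k \<in> {1..N-1}" "\<forall>i<k. x i \<in> \<Lambda>" "0 < kernel_det K k x" for k x
  proof -
    have "0 < D k x"
      using that by (simp add: D_def less_complex_def)
    then show ?thesis
      using that prob_space_eta[of k x] space by (auto simp: eta_def)
  qed
  have schur: "mat_inverse (kernel_matrix K k x) \<noteq> None
      \<and> (\<forall>y\<in>\<Lambda>. 0 \<le> schur_density K N k x y
           \<and> eta_next_density K N k x y = schur_density K N k x y)
      \<and> eta_next \<nu> K N k x = density \<nu> (\<lambda>y. ennreal (Re (schur_density K N k x y)))"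
    if k: "k \<in> {1..N-1}" and x: "\<forall>i<k. x i \<in> \<Lambda>" and pos: "0 < kernel_det K k x" for k x
  proof -
    \<comment> \<open>Pure algebra, valid for every y, so the two densities can be interchanged
      without restricting to \<open>\<Lambda>\<close>.\<close>
    have eq: "eta_next_density K N k x y = schur_density K N k x y" for y
      using pos by (intro eta_next_density_eq_schur_density) auto
    have "0 \<le> eta_next_density K N k x y" if y: "y \<in> \<Lambda>" for y
    proof -
      have "eta_next_density K N k x y = of_real (cond_density k x y)"
        using k x y pos space by (intro eta_next_density_eq_cond_density) auto
      then show ?thesis
        using cond_density_nonneg[of k x y] x y space by (simp add: less_eq_complex_def)
    qed
    moreover have "mat_inverse (kernel_matrix K k x) \<noteq> None"
      using pos mat_inverse_adjugate[OF kernel_matrix_carrier, of K k x] by (auto simp: kernel_det_def)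
    ultimately show ?thesis
      using pos by (simp add: eq eta_next_def)
  qed
  \<comment> \<open>The first law is \<open>eta\<close> at k = 0, where the determinant is 1 and
    hence positive.\<close>
  have "prob_space (eta_first \<nu> K N)"
    using prob_space_eta[of 0 undefined] N_pos by (simp add: eta_def)
  then show ?thesis
    using prob_space_determinantal_law AE_determinantal_law_pos eta_next_prob schur
      nn_integral_determinantal_law sequential_law_eq[of N] determinantal_law_eq by simp
qed

end
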